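(* Let $A \in \mathbb{R}^{n\times n}$ be a hidden $Z$-matrix. Suppose there exists a vector $x \in \mathbb{R}^n$ with $x > 0$ (componentwise) such that $Ax \geq 0$ (componentwise). Then $A$ is a $P_0$-matrix.
   Context: All matrices are real, and vector inequalities are componentwise. A square matrix is a $Z$-matrix if all its off-diagonal entries are nonpositive. A matrix $A \in \mathbb{R}^{n\times n}$ is a hidden $Z$-matrix if there exist $Z$-matrices $X, Y \in \mathbb{R}^{n\times n}$ and vectors $r, s \in \mathbb{R}^n_+$ (nonnegative vectors) such that $AX = Y$ and $r^TX + s^TY > 0$. A square matrix is a $P_0$-matrix if all its principal minors are nonnegative. *)

theory Defs
  imports "Jordan_Normal_Form.Determinant" "Jordan_Normal_Form.DL_Submatrix"
begin

(* The order \<le> on vectors in Jordan_Normal_Form is componentwise, but < on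
   vectors only means "\<le> and not \<ge>"; hence a separate notion of strict positivity. *)
definition pos_vec :: "real vec \<Rightarrow> bool" where
  "pos_vec v \<longleftrightarrow> (\<forall>i < dim_vec v. 0 < v $ i)"

definition Z_matrix :: "real mat \<Rightarrow> bool" where
  "Z_matrix A \<longleftrightarrow> square_mat A \<and>
     (\<forall>i < dim_row A. \<forall>j < dim_col A. i \<noteq> j \<longrightarrow> A $$ (i, j) \<le> 0)"

(* The row vector r\<^sup>T X + s\<^sup>T Y is written as the column vector X\<^sup>T r + Y\<^sup>T s. *)
definition hidden_Z_matrix :: "real mat \<Rightarrow> bool" where
  "hidden_Z_matrix A \<longleftrightarrow> square_mat A \<and>
     (let n = dim_row A in
      \<exists>X \<in> carrier_mat n n. \<exists>Y \<in> carrier_mat n n. \<exists>r \<in> carrier_vec n. \<exists>s \<in> carrier_vec n.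
        Z_matrix X \<and> Z_matrix Y \<and> 0\<^sub>v n \<le> r \<and> 0\<^sub>v n \<le> s \<and>
        A * X = Y \<and> pos_vec (transpose_mat X *\<^sub>v r + transpose_mat Y *\<^sub>v s))"

definition P0_matrix :: "real mat \<Rightarrow> bool" where
  "P0_matrix A \<longleftrightarrow> square_mat A \<and>
     (\<forall>I. I \<subseteq> {..<dim_row A} \<and> I \<noteq> {} \<longrightarrow> 0 \<le> det (submatrix A I I))"

end

theory Submission
  imports Defs
begin

text \<open>
  Write \<open>Y = A X\<close>. The matrix \<open>W = diag r X + diag s Y\<close> is a Z-matrix with positive column sums,
  which makes it nonsingular with nonnegative inverse. As \<open>W = (diag r + diag s A) X\<close>, the matrix
  \<open>X\<close> is nonsingular, and if \<open>X v = x\<close>, then \<open>W v = diag r x + diag s (A x) \<ge> 0\<close> gives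
  \<open>v \<ge> 0\<close>. Hence for all diagonals \<open>d > 0\<close> and \<open>e \<ge> 0\<close> the Z-matrix \<open>diag d X + diag e Y\<close> maps
  \<open>v\<close> to a positive vector, so it is nonsingular, and so is \<open>diag d + diag e A\<close>.
  Taking \<open>d = t\<close>, \<open>e = 1 - t\<close> on \<open>I\<close> and \<open>d = 1\<close>, \<open>e = 0\<close> off \<open>I\<close>, one sees that
  \<open>(1 - t) A\<^sub>I\<^sub>I + t 1\<close> is nonsingular for \<open>0 < t \<le> 1\<close>. Its determinant is \<open>1\<close> at \<open>t = 1\<close>, so by
  the intermediate value theorem it is nonnegative at \<open>t = 0\<close>.
\<close>

section \<open>Linear systems and continuity of the determinant\<close>

lemma mult_mat_vec_index_sum:
  assumes "A \<in> carrier_mat n m" "v \<in> carrier_vec m" "i < n"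
  shows "(A *\<^sub>v v) $ i = (\<Sum>j<m. A $$ (i, j) * v $ j)"
  using assms by (auto simp: scalar_prod_def atLeast0LessThan intro!: sum.cong)

text \<open>Cramer's rule: \<open>X * adj_mat X\<close> is \<open>det X\<close> times the identity,
  so the adjugate applied to \<open>b\<close> scaled by \<open>1 / det X\<close> is a
  solution.\<close>

lemma det_nonzero_imp_mult_vec_surj:
  fixes X :: "'a :: field mat"
  assumes X: "X \<in> carrier_mat n n" and "det X \<noteq> 0" and b: "b \<in> carrier_vec n"
  obtains v where "v \<in> carrier_vec n" "X *\<^sub>v v = b"
proof
  let ?w = "(1 / det X) \<cdot>\<^sub>v b"
  have w: "?w \<in> carrier_vec n" using b by simp
  note adj = adj_mat[OF X]
  show "adj_mat X *\<^sub>v ?w \<in> carrier_vec n" using adj(1) w by (rule mult_mat_vec_carrier)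
  have "X *\<^sub>v (adj_mat X *\<^sub>v ?w) = (X * adj_mat X) *\<^sub>v ?w"
    using assoc_mult_mat_vec[OF X adj(1) w] by simp
  also have "\<dots> = b"
    unfolding adj(2) using b \<open>det X \<noteq> 0\<close>
    by (intro eq_vecI) (auto simp: scalar_prod_smult_distrib)
  finally show "X *\<^sub>v (adj_mat X *\<^sub>v ?w) = b" .
qed

text \<open>The Leibniz expansion is a polynomial in the entries.\<close>

lemma continuous_on_det:
  fixes F :: "'b :: topological_space \<Rightarrow> 'a :: real_normed_field mat"
  assumes "\<And>t. t \<in> S \<Longrightarrow> F t \<in> carrier_mat n n"
    and "\<And>i j. i < n \<Longrightarrow> j < n \<Longrightarrow> continuous_on S (\<lambda>t. F t $$ (i, j))"
  shows "continuous_on S (\<lambda>t. det (F t))"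
proof -
  have "continuous_on S (\<lambda>t. \<Sum>p | p permutes {0..<n}. signof p * (\<Prod>i = 0..<n. F t $$ (i, p i)))"
    by (intro continuous_intros assms(2)) (auto simp: permutes_in_image)
  then show ?thesis
    by (subst continuous_on_cong[OF refl det_def'[OF assms(1)]])
qed

section \<open>Z-matrices with positive weighted column sums\<close>

text \<open>The sum of \<open>p\<^sub>i (W v)\<^sub>i\<close> over the set where \<open>v\<^sub>i < 0\<close> is negative unless that set is empty.\<close>

lemma Z_matrix_weighted_col_mono:
  assumes W: "W \<in> carrier_mat n n" "Z_matrix W"
    and p: "p \<in> carrier_vec n" "pos_vec p" "pos_vec (transpose_mat W *\<^sub>v p)"
    and v: "v \<in> carrier_vec n" "0\<^sub>v n \<le> W *\<^sub>v v"
  shows "0\<^sub>v n \<le> v"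
proof (rule ccontr)
  define N where "N = {i. i < n \<and> v $ i < 0}"
  assume "\<not> 0\<^sub>v n \<le> v"
  then have "N \<noteq> {}" using v(1) by (auto simp: N_def less_eq_vec_def not_le)
  have N: "N \<subseteq> {..<n}" and [simp]: "finite N" by (auto simp: N_def)
  have p_pos: "p $ i > 0" if "i < n" for i using p that by (auto simp: pos_vec_def)
  have Z: "W $$ (i, j) \<le> 0" if "i < n" "j < n" "i \<noteq> j" for i j
    using W that by (auto simp: Z_matrix_def)
  have pW: "(\<Sum>i<n. W $$ (i, j) * p $ i) > 0" if "j < n" for j
  proof -
    have "(transpose_mat W *\<^sub>v p) $ j > 0" using p(3) that W by (auto simp: pos_vec_def)
    then show ?thesis
      using W that p(1) by (subst (asm) mult_mat_vec_index_sum[of _ n n]) auto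
  qed
  \<comment> \<open>For a column in \<open>N\<close>, the rows outside \<open>N\<close> hold
    off-diagonal entries only; dropping these nonpositive terms cannot lower the positive full
    sum.\<close>
  have in_N: "(\<Sum>i\<in>N. W $$ (i, j) * p $ i) > 0" if "j \<in> N" for j
  proof -
    have "(\<Sum>i<n. W $$ (i, j) * p $ i)
        = (\<Sum>i\<in>N. W $$ (i, j) * p $ i) + (\<Sum>i\<in>{..<n} - N. W $$ (i, j) * p $ i)"
      using N by (subst sum.subset_diff[of N]) auto
    moreover have "(\<Sum>i\<in>{..<n} - N. W $$ (i, j) * p $ i) \<le> 0"
      using that N
      by (intro sum_nonpos mult_nonpos_nonneg Z) (auto intro!: less_imp_le[OF p_pos])
    ultimately show ?thesis using pW[of j] that N by auto
  qed
  have off_N: "(\<Sum>i\<in>N. W $$ (i, j) * p $ i) \<le> 0" if "j < n" "j \<notin> N" for j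
    using that N by (intro sum_nonpos mult_nonpos_nonneg Z) (auto intro!: less_imp_le[OF p_pos])
  have "0 \<le> (\<Sum>i\<in>N. p $ i * (W *\<^sub>v v) $ i)"
    using N v(2) W by (intro sum_nonneg mult_nonneg_nonneg) (auto intro!: less_imp_le[OF p_pos] simp: less_eq_vec_def)
  also have "\<dots> = (\<Sum>i\<in>N. p $ i * (\<Sum>j<n. W $$ (i, j) * v $ j))"
    using N by (intro sum.cong refl) (auto simp: mult_mat_vec_index_sum[OF W(1) v(1)])
  also have "\<dots> = (\<Sum>j<n. v $ j * (\<Sum>i\<in>N. W $$ (i, j) * p $ i))"
    unfolding sum_distrib_left by (subst sum.swap) (simp add: mult_ac)
  \<comment> \<open>Off \<open>N\<close> a nonnegative \<open>v $ j\<close> meets a nonpositive sum;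
    on \<open>N\<close> a negative one meets a positive sum, and \<open>N\<close> is
    nonempty.\<close>
  also have "\<dots> < (\<Sum>j<n. 0)"
  proof (rule sum_strict_mono_ex1)
    show "\<forall>j\<in>{..<n}. v $ j * (\<Sum>i\<in>N. W $$ (i, j) * p $ i) \<le> 0"
    proof
      fix j assume "j \<in> {..<n}"
      then show "v $ j * (\<Sum>i\<in>N. W $$ (i, j) * p $ i) \<le> 0"
        using in_N[of j] off_N[of j]
        by (cases "j \<in> N") (auto simp: N_def mult_le_0_iff not_less)
    qed
    obtain j where "j \<in> N" using \<open>N \<noteq> {}\<close> by auto
    then show "\<exists>j\<in>{..<n}. v $ j * (\<Sum>i\<in>N. W $$ (i, j) * p $ i) < 0"
      using in_N[of j] by (auto simp: N_def mult_less_0_iff)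
  qed simp
  finally show False by simp
qed

text \<open>Monotonicity applies to a kernel vector and to its negative, so both are nonnegative and
  the vector vanishes.\<close>

lemma Z_matrix_weighted_col_det_nonzero:
  assumes W: "W \<in> carrier_mat n n" "Z_matrix W"
    and p: "p \<in> carrier_vec n" "pos_vec p" "pos_vec (transpose_mat W *\<^sub>v p)"
  shows "det W \<noteq> 0"
proof
  assume "det W = 0"
  then obtain v where v: "v \<in> carrier_vec n" "v \<noteq> 0\<^sub>v n" "W *\<^sub>v v = 0\<^sub>v n"
    using det_0_iff_vec_prod_zero[OF W(1)] by auto
  have "W *\<^sub>v (- v) = - (W *\<^sub>v v)"
    using W(1) v(1) by (intro eq_vecI) auto
  then have "W *\<^sub>v (- v) = 0\<^sub>v n" unfolding v(3) by simp
  then have "0\<^sub>v n \<le> v" "0\<^sub>v n \<le> - v"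
    using Z_matrix_weighted_col_mono[OF W p] v(1,3) by simp_all
  then have "v = 0\<^sub>v n"
    using v(1) by (intro eq_vecI) (auto simp: less_eq_vec_def intro: antisym)
  with v show False by simp
qed

lemma Z_matrix_transpose: "Z_matrix A \<Longrightarrow> Z_matrix (transpose_mat A)"
  by (auto simp: Z_matrix_def)

text \<open>The vector \<open>v\<close> is in fact strictly positive, so it can serve as the weight
  \<open>p\<close> for the transpose of \<open>M\<close>.\<close>

lemma Z_matrix_semipositive_det_nonzero:
  assumes M: "M \<in> carrier_mat n n" "Z_matrix M"
    and v: "v \<in> carrier_vec n" "0\<^sub>v n \<le> v" "pos_vec (M *\<^sub>v v)"
  shows "det M \<noteq> 0"
proof -
  have "pos_vec v"
    unfolding pos_vec_def
  proof (intro allI impI, rule ccontr)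
    fix i assume i: "i < dim_vec v" "\<not> 0 < v $ i"
    then have "v $ i = 0" using v by (auto simp: less_eq_vec_def intro: antisym)
    \<comment> \<open>The diagonal term vanishes with \<open>v $ i\<close>, and all others are
      nonpositive, which contradicts positivity of row \<open>i\<close>.\<close>
    then have "M $$ (i, j) * v $ j \<le> 0" if "j < n" for j
      using M v i that
      by (cases "i = j") (auto simp: Z_matrix_def less_eq_vec_def intro!: mult_nonpos_nonneg)
    then have "(\<Sum>j<n. M $$ (i, j) * v $ j) \<le> 0" by (intro sum_nonpos) auto
    moreover have "(M *\<^sub>v v) $ i > 0" using i M v by (auto simp: pos_vec_def)
    ultimately show False using i mult_mat_vec_index_sum[OF M(1) v(1), of i] v(1) by auto
  qed
  then have "det (transpose_mat M) \<noteq> 0"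
    using M v by (intro Z_matrix_weighted_col_det_nonzero[of _ n v] Z_matrix_transpose) auto
  then show ?thesis using det_transpose[OF M(1)] by simp
qed

section \<open>Nonsingularity of \<open>diag d + diag e * A\<close>\<close>

text \<open>This is \<open>diag d * X + diag e * Y\<close>; the entrywise form keeps the Z-matrix
  sign conditions visible.\<close>

definition row_comb :: "real vec \<Rightarrow> real vec \<Rightarrow> real mat \<Rightarrow> real mat \<Rightarrow> real mat" where
  "row_comb d e X Y = mat (dim_row X) (dim_col X) (\<lambda>(i, j). d $ i * X $$ (i, j) + e $ i * Y $$ (i, j))"

lemma row_comb_carrier: "X \<in> carrier_mat n m \<Longrightarrow> row_comb d e X Y \<in> carrier_mat n m"
  by (simp add: row_comb_def)

lemma Z_matrix_row_comb:
  assumes "X \<in> carrier_mat n n" "Y \<in> carrier_mat n n" "Z_matrix X" "Z_matrix Y"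
    and "0\<^sub>v n \<le> d" "0\<^sub>v n \<le> e"
  shows "Z_matrix (row_comb d e X Y)"
  using assms
  by (auto simp: Z_matrix_def row_comb_def less_eq_vec_def
      intro!: add_nonpos_nonpos mult_nonneg_nonpos)

lemma row_comb_mult_vec_index:
  assumes "X \<in> carrier_mat n m" "Y \<in> carrier_mat n m" "v \<in> carrier_vec m" "i < n"
  shows "(row_comb d e X Y *\<^sub>v v) $ i = d $ i * (X *\<^sub>v v) $ i + e $ i * (Y *\<^sub>v v) $ i"
  unfolding mult_mat_vec_index_sum[OF row_comb_carrier[OF assms(1)] assms(3,4)]
    mult_mat_vec_index_sum[OF assms(1,3,4)] mult_mat_vec_index_sum[OF assms(2,3,4)]
  using assms by (simp add: row_comb_def sum_distrib_left sum.distrib algebra_simps)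

text \<open>Substituting \<open>u = X w\<close> turns the equations into
  \<open>row_comb d e X Y *\<^sub>v w = 0\<^sub>v n\<close>, a system with a nonsingular
  Z-matrix.\<close>

lemma hidden_Z_matrix_diag_comb_inj:
  assumes A: "A \<in> carrier_mat n n" "hidden_Z_matrix A"
    and x: "x \<in> carrier_vec n" "pos_vec x" "0\<^sub>v n \<le> A *\<^sub>v x"
    and d: "d \<in> carrier_vec n" "pos_vec d" and e: "e \<in> carrier_vec n" "0\<^sub>v n \<le> e"
    and u: "u \<in> carrier_vec n" "\<And>i. i < n \<Longrightarrow> d $ i * u $ i + e $ i * (A *\<^sub>v u) $ i = 0"
  shows "u = 0\<^sub>v n"
proof -
  obtain X Y r s where X: "X \<in> carrier_mat n n" "Z_matrix X" and Y: "Y \<in> carrier_mat n n" "Z_matrix Y"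
    and r: "r \<in> carrier_vec n" "0\<^sub>v n \<le> r" and s: "s \<in> carrier_vec n" "0\<^sub>v n \<le> s"
    and AX: "A * X = Y" and pos: "pos_vec (transpose_mat X *\<^sub>v r + transpose_mat Y *\<^sub>v s)"
    using A unfolding hidden_Z_matrix_def Let_def by auto
  have Y_mult: "Y *\<^sub>v w = A *\<^sub>v (X *\<^sub>v w)" if "w \<in> carrier_vec n" for w
    using assoc_mult_mat_vec[OF A(1) X(1) that] AX by simp
  define W where "W = row_comb r s X Y"
  \<comment> \<open>With unit weights, the weighted column sums of \<open>W\<close> are exactly the
    entries of the positive vector in the hidden Z condition.\<close>
  define p :: "real vec" where "p = vec n (\<lambda>_. 1)"
  have W: "W \<in> carrier_mat n n" "Z_matrix W"
    unfolding W_def using X Y r s by (auto intro: row_comb_carrier Z_matrix_row_comb)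
  have p: "p \<in> carrier_vec n" "pos_vec p" by (auto simp: p_def pos_vec_def)
  have "transpose_mat W *\<^sub>v p = transpose_mat X *\<^sub>v r + transpose_mat Y *\<^sub>v s"
  proof (rule eq_vecI)
    fix j assume "j < dim_vec (transpose_mat X *\<^sub>v r + transpose_mat Y *\<^sub>v s)"
    then have j: "j < n" using Y by simp
    have T: "transpose_mat W \<in> carrier_mat n n" "transpose_mat X \<in> carrier_mat n n"
      "transpose_mat Y \<in> carrier_mat n n" using W X Y by auto
    show "(transpose_mat W *\<^sub>v p) $ j = (transpose_mat X *\<^sub>v r + transpose_mat Y *\<^sub>v s) $ j"
      unfolding mult_mat_vec_index_sum[OF T(1) p(1) j]
      using j X Y T r s
        mult_mat_vec_index_sum[OF T(2) r(1) j] mult_mat_vec_index_sum[OF T(3) s(1) j]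
      by (auto simp del: index_mult_mat_vec simp: W_def p_def row_comb_def sum.distrib mult_ac)
  qed (use W Y in auto)
  then have Wp: "pos_vec (transpose_mat W *\<^sub>v p)" using pos by simp
  have "det X \<noteq> 0"
  proof
    assume "det X = 0"
    then obtain w where w: "w \<in> carrier_vec n" "w \<noteq> 0\<^sub>v n" "X *\<^sub>v w = 0\<^sub>v n"
      using det_0_iff_vec_prod_zero[OF X(1)] by auto
    \<comment> \<open>Since \<open>Y w = A (X w)\<close>, the kernel of \<open>X\<close> lies in
      that of \<open>W\<close>.\<close>
    have "W *\<^sub>v w = 0\<^sub>v n"
    proof (rule eq_vecI)
      fix i assume "i < dim_vec (0\<^sub>v n :: real vec)"
      then have i: "i < n" by simp
      show "(W *\<^sub>v w) $ i = 0\<^sub>v n $ i"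
        unfolding W_def row_comb_mult_vec_index[OF X(1) Y(1) w(1) i] Y_mult[OF w(1)] w(3)
        using i A by simp
    qed (use W in simp)
    then have "det W = 0" using w det_0_iff_vec_prod_zero[OF W(1)] by auto
    then show False using Z_matrix_weighted_col_det_nonzero[OF W p Wp] by simp
  qed
  then obtain v where v: "v \<in> carrier_vec n" "X *\<^sub>v v = x"
    using det_nonzero_imp_mult_vec_surj[OF X(1) _ x(1)] by blast
  have x_pos: "x $ i > 0" and Ax: "(A *\<^sub>v x) $ i \<ge> 0" if "i < n" for i
    using x that A by (auto simp del: index_mult_mat_vec simp: pos_vec_def less_eq_vec_def)
  have "0\<^sub>v n \<le> W *\<^sub>v v"
    unfolding less_eq_vec_def
  proof safe
    fix i assume "i < dim_vec (W *\<^sub>v v)"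
    then have i: "i < n" using W by simp
    show "0\<^sub>v n $ i \<le> (W *\<^sub>v v) $ i"
      unfolding W_def row_comb_mult_vec_index[OF X(1) Y(1) v(1) i] Y_mult[OF v(1)] v(2)
      using i x_pos[OF i] Ax[OF i] r s
      by (auto simp del: index_mult_mat_vec simp: less_eq_vec_def)
  qed (use W in simp)
  then have v_nonneg: "0\<^sub>v n \<le> v" using Z_matrix_weighted_col_mono[OF W p Wp v(1)] by simp
  define M where "M = row_comb d e X Y"
  have d_pos: "d $ i > 0" if "i < n" for i using d that by (auto simp: pos_vec_def)
  then have "0\<^sub>v n \<le> d" using d(1) by (auto simp: less_eq_vec_def intro: less_imp_le)
  then have M: "M \<in> carrier_mat n n" "Z_matrix M"
    unfolding M_def using X Y e by (auto intro: row_comb_carrier Z_matrix_row_comb)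
  \<comment> \<open>Row \<open>i\<close> gives \<open>d $ i * x $ i\<close> plus a nonnegative term;
    strict positivity of \<open>d\<close> and \<open>x\<close> is what makes it positive.\<close>
  have "pos_vec (M *\<^sub>v v)"
    unfolding pos_vec_def
  proof (intro allI impI)
    fix i assume "i < dim_vec (M *\<^sub>v v)"
    then have i: "i < n" using M by simp
    show "0 < (M *\<^sub>v v) $ i"
      unfolding M_def row_comb_mult_vec_index[OF X(1) Y(1) v(1) i] Y_mult[OF v(1)] v(2)
      using i x_pos[OF i] Ax[OF i] d_pos[OF i] e
      by (auto simp del: index_mult_mat_vec simp: less_eq_vec_def intro!: add_pos_nonneg)
  qed
  then have det_M: "det M \<noteq> 0" using Z_matrix_semipositive_det_nonzero[OF M v(1) v_nonneg] by simp
  obtain w where w: "w \<in> carrier_vec n" "X *\<^sub>v w = u"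
    using det_nonzero_imp_mult_vec_surj[OF X(1) \<open>det X \<noteq> 0\<close> u(1)] by blast
  have "M *\<^sub>v w = 0\<^sub>v n"
  proof (rule eq_vecI)
    fix i assume "i < dim_vec (0\<^sub>v n :: real vec)"
    then have i: "i < n" by simp
    show "(M *\<^sub>v w) $ i = 0\<^sub>v n $ i"
      unfolding M_def row_comb_mult_vec_index[OF X(1) Y(1) w(1) i] Y_mult[OF w(1)] w(2)
      using u(2)[OF i] i by simp
  qed (use M in simp)
  then have "w = 0\<^sub>v n" using det_M w det_0_iff_vec_prod_zero[OF M(1)] by auto
  then show ?thesis using w X by auto
qed

section \<open>From nonsingularity to principal minors\<close>

text \<open>The inverse sends an element of \<open>I\<close> to its rank, the number of smaller
  elements of \<open>I\<close>. The bijection turns sums over \<open>I\<close> into sums over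
  submatrix indices.\<close>

lemma bij_betw_pick:
  assumes "finite I"
  shows "bij_betw (pick I) {..<card I} I"
proof (rule bij_betwI[where g = "\<lambda>i. card {a\<in>I. a < i}"])
  show "pick I \<in> {..<card I} \<rightarrow> I" by (auto intro: pick_in_set_le)
  show "(\<lambda>i. card {a\<in>I. a < i}) \<in> I \<rightarrow> {..<card I}"
    using assms by (auto intro!: psubset_card_mono)
qed (auto simp: card_pick pick_card_in_set)

lemma P0_matrix_if_diag_comb_inj:
  assumes A: "A \<in> carrier_mat n n"
    and inj: "\<And>d e u. d \<in> carrier_vec n \<Longrightarrow> pos_vec d \<Longrightarrow> e \<in> carrier_vec n \<Longrightarrow> 0\<^sub>v n \<le> e \<Longrightarrow>
      u \<in> carrier_vec n \<Longrightarrow> (\<And>i. i < n \<Longrightarrow> d $ i * u $ i + e $ i * (A *\<^sub>v u) $ i = 0) \<Longrightarrow> u = 0\<^sub>v n"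
  shows "P0_matrix A"
  unfolding P0_matrix_def
proof (intro conjI allI impI)
  show "square_mat A" using A by simp
next
  fix I assume "I \<subseteq> {..<dim_row A} \<and> I \<noteq> {}"
  then have I: "I \<subseteq> {..<n}" using A by simp
  then have fin: "finite I" by (rule finite_subset) simp
  define k where "k = card I"
  define C where "C = submatrix A I I"
  have "{i. i < n \<and> i \<in> I} = I" using I by auto
  then have C: "C \<in> carrier_mat k k"
    and C_index: "\<And>a b. a < k \<Longrightarrow> b < k \<Longrightarrow> C $$ (a, b) = A $$ (pick I a, pick I b)"
    unfolding C_def k_def submatrix_def using A by auto
  have pick_bij: "bij_betw (pick I) {..<k} I" unfolding k_def using fin by (rule bij_betw_pick)
  \<comment> \<open>The segment from \<open>C\<close> at \<open>t = 0\<close> to the identity at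
    \<open>t = 1\<close>.\<close>
  define F where "F t = mat k k (\<lambda>(a, b). (1 - t) * C $$ (a, b) + (if a = b then t else 0))" for t :: real
  have F: "F t \<in> carrier_mat k k" for t by (simp add: F_def)
  have F_nonzero: "det (F t) \<noteq> 0" if t: "0 < t" "t \<le> 1" for t
  proof
    assume "det (F t) = 0"
    then obtain w where w: "w \<in> carrier_vec k" "w \<noteq> 0\<^sub>v k" "F t *\<^sub>v w = 0\<^sub>v k"
      using det_0_iff_vec_prod_zero[OF F] by auto
    \<comment> \<open>A kernel vector \<open>w\<close> of \<open>F t\<close> is extended by zero
      outside \<open>I\<close>. There \<open>d = 1\<close> and \<open>e = 0\<close> reduce the
      equation to \<open>u $ i = 0\<close>; on \<open>I\<close> it is a row of
      \<open>F t *\<^sub>v w = 0\<^sub>v k\<close>. The bounds on \<open>t\<close> make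
      \<open>d\<close> positive and \<open>e\<close> nonnegative.\<close>
    define u where "u = vec n (\<lambda>i. if i \<in> I then w $ (card {a\<in>I. a < i}) else 0)"
    define d where "d = vec n (\<lambda>i. if i \<in> I then t else 1)"
    define e where "e = vec n (\<lambda>i. if i \<in> I then 1 - t else 0)"
    have u_pick: "u $ pick I a = w $ a" if "a < k" for a
      using that I bij_betw_apply[OF pick_bij, of a]
      by (auto simp: u_def k_def card_pick)
    have Au_pick: "(A *\<^sub>v u) $ pick I a = (\<Sum>b<k. C $$ (a, b) * w $ b)" if a: "a < k" for a
    proof -
      have "pick I a < n" using a I bij_betw_apply[OF pick_bij, of a] by auto
      then have "(A *\<^sub>v u) $ pick I a = (\<Sum>j<n. A $$ (pick I a, j) * u $ j)"
        using A by (intro mult_mat_vec_index_sum) (auto simp: u_def)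
      also have "\<dots> = (\<Sum>j\<in>I. A $$ (pick I a, j) * u $ j)"
        using I by (intro sum.mono_neutral_right) (auto simp: u_def)
      also have "\<dots> = (\<Sum>b<k. A $$ (pick I a, pick I b) * u $ pick I b)"
        by (rule sum.reindex_bij_betw[OF pick_bij, symmetric])
      finally show ?thesis using a by (simp add: C_index u_pick)
    qed
    have "u = 0\<^sub>v n"
    proof (rule inj[of d e])
      fix i assume i: "i < n"
      show "d $ i * u $ i + e $ i * (A *\<^sub>v u) $ i = 0"
      proof (cases "i \<in> I")
        case True
        then obtain a where a: "a < k" "i = pick I a"
          using bij_betw_imp_surj_on[OF pick_bij] by auto
        have "0 = (F t *\<^sub>v w) $ a" using w a by simp
        also have "\<dots> = (\<Sum>b<k. F t $$ (a, b) * w $ b)"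
          by (rule mult_mat_vec_index_sum[OF F w(1) a(1)])
        also have "\<dots> = (\<Sum>b<k. (1 - t) * (C $$ (a, b) * w $ b) + (if a = b then t * w $ b else 0))"
          using a by (intro sum.cong) (auto simp: F_def algebra_simps)
        also have "\<dots> = (1 - t) * (\<Sum>b<k. C $$ (a, b) * w $ b) + t * w $ a"
          using a by (simp add: sum.distrib sum_distrib_left)
        finally show ?thesis
          using True i u_pick[OF a(1)] Au_pick[OF a(1)] a(2)
          by (simp del: index_mult_mat_vec add: d_def e_def)
      qed (use i in \<open>auto simp: u_def d_def e_def\<close>)
    qed (use t in \<open>auto simp: u_def d_def e_def pos_vec_def less_eq_vec_def\<close>)
    then have "w $ a = 0" if "a < k" for a
      using u_pick[OF that] that I bij_betw_apply[OF pick_bij, of a] by auto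
    then have "w = 0\<^sub>v k" using w(1) by (intro eq_vecI) auto
    with w(2) show False by simp
  qed
  have cont: "continuous_on {0..1} (\<lambda>t. det (F t))"
  proof (rule continuous_on_det[OF F])
    fix a b assume "a < k" "b < k"
    then show "continuous_on {0..1} (\<lambda>t. F t $$ (a, b))"
      by (cases "a = b") (auto simp: F_def intro!: continuous_intros)
  qed
  have "F 0 = C" using C by (intro eq_matI) (auto simp: F_def)
  moreover have "F 1 = 1\<^sub>m k" by (intro eq_matI) (auto simp: F_def)
  moreover have "0 \<le> det (F 0)"
  proof (rule ccontr)
    assume neg: "\<not> 0 \<le> det (F 0)"
    \<comment> \<open>The zero cannot be at \<open>t = 0\<close>, where the determinant is negative,
      nor in the rest of the interval by \<open>F_nonzero\<close>.\<close>
    then obtain t where "0 \<le> t" "t \<le> 1" "det (F t) = 0"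
      using IVT'[of "\<lambda>t. det (F t)" 0 0 1] cont \<open>F 1 = 1\<^sub>m k\<close> by auto
    with neg F_nonzero[of t] show False by (cases "t = 0") auto
  qed
  ultimately show "0 \<le> det (submatrix A I I)" by (simp add: C_def)
qed

theorem theorem3p2:
  fixes n :: nat and A :: "real mat"
  assumes "A \<in> carrier_mat n n"
    and "hidden_Z_matrix A"
    and "\<exists>x \<in> carrier_vec n. pos_vec x \<and> 0\<^sub>v n \<le> A *\<^sub>v x"
  shows "P0_matrix A"
proof -
  obtain x where x: "x \<in> carrier_vec n" "pos_vec x" "0\<^sub>v n \<le> A *\<^sub>v x"
    using assms(3) by blast
  show ?thesis
    by (rule P0_matrix_if_diag_comb_inj[OF assms(1)])
      (rule hidden_Z_matrix_diag_comb_inj[OF assms(1,2) x])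
qed

end
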